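(* Let $N,n,m,r,p\ge 1$ be integers. For $\ell=1,\dots,N$ let $A_\ell=(A_{\ell ij})_{i,j}\in\mathbb{R}^{n\times m}$ and $b_\ell=(b_{\ell i})_i\in\mathbb{R}^n$. Let $X=(X_{\ell q})\in\mathbb{R}^{N\times r}$ be the path values of a solution basis satisfying $\frac1N\sum_{\ell=1}^N X_{\ell k}X_{\ell q}=\delta_{kq}$ for $k,q=1,\dots,r$. For coefficients $\xi=(\xi_j^q)_{1\le j\le m,\,1\le q\le r}$ with $\xi_j^q\in\mathbb{R}$, define $\phi^r_\ell=(\phi^r_{\ell j})_{j}\in\mathbb{R}^m$ by $\phi^r_{\ell j}=\sum_{q=1}^r \xi_j^q X_{\ell q}$. Assume that there exist coefficients $\xi_j^q$ such that $$A_\ell\phi^r_\ell=b_\ell\qquad\text{for all }\ell=1,\dots,N.$$ Then: (1) These coefficients solve the empirical $L^2$ normal equations $$\sum_{k=1}^m\sum_{u=1}^r G_{jk}^{qu}\,\xi_k^u=h_j^q,\qquad j=1,\dots,m,\ q=1,\dots,r,$$ and, for any test basis with path values $Y=(Y_{\ell s})\in\mathbb{R}^{N\times p}$, they solve the projected moment equations $$\sum_{j=1}^m\sum_{q=1}^r B_{ij}^{sq}\,\xi_j^q=\beta_i^s,\qquad i=1,\dots,n,\ s=1,\dots,p,$$ where $G,h,B,\beta$ are as defined in the context. (2) If the design matrix $\mathcal{D}\in\mathbb{R}^{Nn\times mr}$ (defined in the context) has full column rank $mr$, then $\xi$ is the unique solution of the empirical $L^2$ normal equations. If, for a given test basis $Y$,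 the flattened projected matrix $\mathcal{B}\in\mathbb{R}^{np\times mr}$ (defined in the context) has full column rank $mr$, then $\xi$ is the unique solution of the projected moment equations for that test basis.
   Context: Interpretation: $\ell$ indexes $N$ Monte-Carlo paths, $A_{\ell ij}$ is the pathwise sensitivity of hedge instrument $j$ with respect to model primitive $i$, $b_{\ell i}$ is the pathwise sensitivity of the derivative value with respect to model primitive $i$, and $\phi^r_{\ell j}$ is a hedge ratio represented in the solution basis. Only the arrays of real numbers matter for the statement. The test basis values $Y_{\ell s}$ are arbitrary reals (no orthonormality is assumed for $Y$). Empirical $L^2$ formulation: minimize $\frac1N\sum_{\ell=1}^N\|A_\ell\phi^r_\ell-b_\ell\|_2^2$ over $\xi$. The design matrix $\mathcal{D}$ has rows indexed by $(\ell,i)$ and columns indexed by $(j,q)$, with $$\mathcal{D}_{(\ell,i),(j,q)}=A_{\ell ij}X_{\ell q}.$$ The normal equations of this problem have the coefficients $$G_{jk}^{qu}=\frac1N\sum_{\ell=1}^N\sum_{i=1}^n A_{\ell ij}A_{\ell ik}X_{\ell q}X_{\ell u},\qquad h_j^q=\frac1N\sum_{\ell=1}^N\sum_{i=1}^n A_{\ell ij}b_{\ell i}X_{\ell q},$$ i.e. the normal matrix is $\frac1N\mathcal{D}^\top\mathcal{D}$. Projected moment formulation with test basis $Y$: require $\frac1N\sum_{\ell=1}^N (A_\ell\phi^r_\ell-b_\ell)_i\,Y_{\ell s}=0$ for all $i=1,\dots,n$, $s=1,\dots,p$. This is the system with coefficients $$B_{ij}^{sq}=\frac1N\sum_{\ell=1}^N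 A_{\ell ij}X_{\ell q}Y_{\ell s},\qquad \beta_i^s=\frac1N\sum_{\ell=1}^N b_{\ell i}Y_{\ell s}.$$ The flattened projected matrix $\mathcal{B}$ has rows indexed by $(i,s)$ and columns indexed by $(j,q)$, with $\mathcal{B}_{(i,s),(j,q)}=B_{ij}^{sq}$. *)

theory Defs
  imports "HOL-Analysis.Analysis"
begin

text \<open>
  The index ranges are finite types: \<open>'l\<close> for the \<open>N\<close> paths, \<open>'n\<close> for the model primitives,
  \<open>'m\<close> for the hedge instruments, \<open>'r\<close> for the solution basis and \<open>'p\<close> for the test basis, so that
  e.g. \<open>N = CARD('l)\<close>. Basis values and coefficients are stored with \<open>X $ l $ q\<close> for
  \<open>X\<^sub>l\<^sub>q\<close> and \<open>\<xi> $ j $ q\<close> for \<open>\<xi>\<^sub>j\<^sup>q\<close>.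
\<close>

definition emp_mean :: "('l::finite \<Rightarrow> real) \<Rightarrow> real" where
  "emp_mean f = (1 / real CARD('l)) * (\<Sum>l\<in>UNIV. f l)"

definition emp_orthonormal :: "real ^ 'r ^ 'l \<Rightarrow> bool" where
  "emp_orthonormal X \<longleftrightarrow>
     (\<forall>k q. emp_mean (\<lambda>l. X $ l $ k * X $ l $ q) = (if k = q then 1 else 0))"

definition hedge :: "real ^ 'r ^ 'l \<Rightarrow> real ^ 'r ^ 'm \<Rightarrow> 'l \<Rightarrow> real ^ 'm" where
  "hedge X \<xi> l = (\<chi> j. \<Sum>q\<in>UNIV. \<xi> $ j $ q * X $ l $ q)"

definition design_matrix ::
    "('l::finite \<Rightarrow> real ^ 'm ^ 'n) \<Rightarrow> real ^ 'r ^ 'l \<Rightarrow> real ^ ('m \<times> 'r) ^ ('l \<times> 'n)" where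
  "design_matrix A X = (\<chi> li jq. A (fst li) $ snd li $ fst jq * X $ fst li $ snd jq)"

text \<open>The coefficient \<open>G_coeff A X j k q u\<close> is \<open>G\<^sub>j\<^sub>k\<^sup>q\<^sup>u\<close>, and
  \<open>B_coeff A X Y i j s q\<close> is \<open>B\<^sub>i\<^sub>j\<^sup>s\<^sup>q\<close>.\<close>

definition G_coeff ::
    "('l::finite \<Rightarrow> real ^ 'm ^ 'n) \<Rightarrow> real ^ 'r ^ 'l \<Rightarrow> 'm \<Rightarrow> 'm \<Rightarrow> 'r \<Rightarrow> 'r \<Rightarrow> real" where
  "G_coeff A X j k q u =
     emp_mean (\<lambda>l. \<Sum>i\<in>UNIV. A l $ i $ j * A l $ i $ k * X $ l $ q * X $ l $ u)"

definition h_coeff ::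
    "('l::finite \<Rightarrow> real ^ 'm ^ 'n) \<Rightarrow> ('l \<Rightarrow> real ^ 'n) \<Rightarrow> real ^ 'r ^ 'l \<Rightarrow> 'm \<Rightarrow> 'r \<Rightarrow> real" where
  "h_coeff A b X j q = emp_mean (\<lambda>l. \<Sum>i\<in>UNIV. A l $ i $ j * b l $ i * X $ l $ q)"

definition B_coeff ::
    "('l::finite \<Rightarrow> real ^ 'm ^ 'n) \<Rightarrow> real ^ 'r ^ 'l \<Rightarrow> real ^ 'p ^ 'l
      \<Rightarrow> 'n \<Rightarrow> 'm \<Rightarrow> 'p \<Rightarrow> 'r \<Rightarrow> real" where
  "B_coeff A X Y i j s q = emp_mean (\<lambda>l. A l $ i $ j * X $ l $ q * Y $ l $ s)"

definition beta_coeff ::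
    "('l::finite \<Rightarrow> real ^ 'n) \<Rightarrow> real ^ 'p ^ 'l \<Rightarrow> 'n \<Rightarrow> 'p \<Rightarrow> real" where
  "beta_coeff b Y i s = emp_mean (\<lambda>l. b l $ i * Y $ l $ s)"

definition projected_matrix ::
    "('l::finite \<Rightarrow> real ^ 'm ^ 'n) \<Rightarrow> real ^ 'r ^ 'l \<Rightarrow> real ^ 'p ^ 'l
      \<Rightarrow> real ^ ('m \<times> 'r) ^ ('n \<times> 'p)" where
  "projected_matrix A X Y =
     (\<chi> is jq. B_coeff A X Y (fst is) (fst jq) (snd is) (snd jq))"

definition solves_normal_equations ::
    "('l::finite \<Rightarrow> real ^ 'm ^ 'n) \<Rightarrow> ('l \<Rightarrow> real ^ 'n) \<Rightarrow> real ^ 'r ^ 'l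
      \<Rightarrow> real ^ 'r ^ 'm \<Rightarrow> bool" where
  "solves_normal_equations A b X \<xi> \<longleftrightarrow>
     (\<forall>j q. (\<Sum>k\<in>UNIV. \<Sum>u\<in>UNIV. G_coeff A X j k q u * \<xi> $ k $ u) = h_coeff A b X j q)"

definition solves_moment_equations ::
    "('l::finite \<Rightarrow> real ^ 'm ^ 'n) \<Rightarrow> ('l \<Rightarrow> real ^ 'n) \<Rightarrow> real ^ 'r ^ 'l \<Rightarrow> real ^ 'p ^ 'l
      \<Rightarrow> real ^ 'r ^ 'm \<Rightarrow> bool" where
  "solves_moment_equations A b X Y \<xi> \<longleftrightarrow>
     (\<forall>i s. (\<Sum>j\<in>UNIV. \<Sum>q\<in>UNIV. B_coeff A X Y i j s q * \<xi> $ j $ q) = beta_coeff b Y i s)"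

end

theory Submission
  imports Defs
begin

text \<open>
  Flattening the coefficients to a vector \<open>v\<close> turns the normal equations into
  \<open>D\<^sup>T (D v) = D\<^sup>T c\<close>, where \<open>c\<close> flattens \<open>b\<close>, and the moment equations into \<open>P v = \<beta>\<close>.
  Replication says \<open>D v = c\<close>, from which both systems follow by linearity of the mean. Full column
  rank makes \<open>D\<close> respectively \<open>P\<close> injective; for the normal equations,
  \<open>D\<^sup>T D w = 0\<close> gives \<open>\<parallel>D w\<parallel>\<^sup>2 = 0\<close>, so \<open>D\<^sup>T D\<close> inherits injectivity from \<open>D\<close>.
\<close>

text \<open>The pair index \<open>(j, q)\<close> is the column index of both
  \<open>design_matrix\<close> and \<open>projected_matrix\<close>, so either matrix can act on the
  coefficients.\<close>

definition flatten :: "real ^ 'r ^ 'm \<Rightarrow> real ^ ('m \<times> 'r)" where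
  "flatten \<xi> = (\<chi> jq. \<xi> $ fst jq $ snd jq)"

lemma inj_flatten: "inj flatten"
  by (rule injI) (simp add: flatten_def vec_eq_iff)

lemma sum_UNIV_prod:
  "(\<Sum>jq\<in>UNIV. f (fst jq) (snd jq)) = (\<Sum>j\<in>UNIV. \<Sum>q\<in>UNIV. f j q)"
  by (simp add: sum.cartesian_product case_prod_beta flip: UNIV_Times_UNIV)

lemma emp_mean_sum: "emp_mean (\<lambda>l. \<Sum>i\<in>S. f i l) = (\<Sum>i\<in>S. emp_mean (f i))"
  unfolding emp_mean_def by (subst sum.swap) (simp add: sum_distrib_left)

lemma emp_mean_mult_right: "emp_mean f * c = emp_mean (\<lambda>l. f l * c)"
  by (simp add: emp_mean_def sum_distrib_right)

text \<open>A type is nonempty, so N > 0 and the factor 1/N cancels.\<close>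

lemma emp_mean_eq_iff:
  fixes f g :: "'l::finite \<Rightarrow> real"
  shows "emp_mean f = emp_mean g \<longleftrightarrow> sum f UNIV = sum g UNIV"
  by (simp add: emp_mean_def)

lemma matrix_vector_hedge:
  "(A *v hedge X \<xi> l) $ i = (\<Sum>j\<in>UNIV. \<Sum>q\<in>UNIV. A $ i $ j * X $ l $ q * \<xi> $ j $ q)"
  by (simp add: matrix_vector_mult_def hedge_def sum_distrib_left mult_ac)

lemma design_matrix_flatten:
  "design_matrix A X *v flatten \<xi> = (\<chi> li. (A (fst li) *v hedge X \<xi> (fst li)) $ snd li)"
  unfolding vec_eq_iff matrix_vector_hedge
  by (simp add: matrix_vector_mult_def design_matrix_def flatten_def
      sum_UNIV_prod[of "\<lambda>j q. A _ $ _ $ j * X $ _ $ q * \<xi> $ j $ q"])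

lemma vector_design_matrix_mult:
  "(c v* design_matrix A X) $ (j, q)
     = (\<Sum>l\<in>UNIV. \<Sum>i\<in>UNIV. A l $ i $ j * c $ (l, i) * X $ l $ q)"
  using sum_UNIV_prod[of "\<lambda>l i. A l $ i $ j * c $ (l, i) * X $ l $ q"]
  by (simp add: vector_matrix_mult_def design_matrix_def mult_ac)

text \<open>Exposes the hedge payoff inside the normal equations, so that replication can replace it
  by \<open>b l\<close> path by path.\<close>

lemma G_coeff_sum:
  "(\<Sum>k\<in>UNIV. \<Sum>u\<in>UNIV. G_coeff A X j k q u * \<xi> $ k $ u)
     = emp_mean (\<lambda>l. \<Sum>i\<in>UNIV. A l $ i $ j * (A l *v hedge X \<xi> l) $ i * X $ l $ q)"
proof -
  have "(\<Sum>k\<in>UNIV. \<Sum>u\<in>UNIV. G_coeff A X j k q u * \<xi> $ k $ u)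
     = emp_mean (\<lambda>l. \<Sum>k\<in>UNIV. \<Sum>u\<in>UNIV. \<Sum>i\<in>UNIV.
         A l $ i $ j * (A l $ i $ k * X $ l $ u * \<xi> $ k $ u) * X $ l $ q)"
    by (simp add: G_coeff_def emp_mean_sum emp_mean_mult_right sum_distrib_right)
      (simp add: mult_ac)
  \<comment> \<open>Two swaps carry the sum over \<open>i\<close> outside those over
    \<open>u\<close> and \<open>k\<close>; the remaining inner double sum is the one in
    \<open>matrix_vector_hedge\<close>.\<close>
  also have "\<dots> = emp_mean (\<lambda>l. \<Sum>k\<in>UNIV. \<Sum>i\<in>UNIV. \<Sum>u\<in>UNIV.
         A l $ i $ j * (A l $ i $ k * X $ l $ u * \<xi> $ k $ u) * X $ l $ q)"
    by (subst sum.swap) (rule refl)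
  also have "\<dots> = emp_mean (\<lambda>l. \<Sum>i\<in>UNIV. \<Sum>k\<in>UNIV. \<Sum>u\<in>UNIV.
         A l $ i $ j * (A l $ i $ k * X $ l $ u * \<xi> $ k $ u) * X $ l $ q)"
    by (subst sum.swap) (rule refl)
  finally show ?thesis
    by (simp add: matrix_vector_hedge sum_distrib_left sum_distrib_right)
qed

lemma B_coeff_sum:
  "(\<Sum>j\<in>UNIV. \<Sum>q\<in>UNIV. B_coeff A X Y i j s q * \<xi> $ j $ q)
     = emp_mean (\<lambda>l. (A l *v hedge X \<xi> l) $ i * Y $ l $ s)"
  by (simp add: B_coeff_def matrix_vector_hedge emp_mean_sum emp_mean_mult_right sum_distrib_right)
    (simp add: mult_ac)

text \<open>Multiplying by \<open>v* D\<close> is applying the transpose of \<open>D\<close>; the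
  common factor 1/N has cancelled on both sides.\<close>

lemma solves_normal_equations_iff:
  "solves_normal_equations A b X \<xi> \<longleftrightarrow>
     (design_matrix A X *v flatten \<xi>) v* design_matrix A X
       = (\<chi> li. b (fst li) $ snd li) v* design_matrix A X"
  by (simp add: solves_normal_equations_def G_coeff_sum h_coeff_def emp_mean_eq_iff vec_eq_iff
      split_paired_all vector_design_matrix_mult design_matrix_flatten)

lemma solves_moment_equations_iff:
  "solves_moment_equations A b X Y \<xi> \<longleftrightarrow>
     projected_matrix A X Y *v flatten \<xi> = (\<chi> is. beta_coeff b Y (fst is) (snd is))"
  by (simp add: solves_moment_equations_def vec_eq_iff matrix_vector_mult_def projected_matrix_def
      flatten_def sum_UNIV_prod[of "\<lambda>j q. B_coeff A X Y _ j _ q * \<xi> $ j $ q"])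

lemma inj_gram:
  fixes D :: "real ^ 'k::finite ^ 'l::finite"
  assumes "inj ((*v) D)"
  shows "inj (\<lambda>v. (D *v v) v* D)"
proof (rule injI)
  fix v w :: "real ^ 'k"
  assume "(D *v v) v* D = (D *v w) v* D"
  \<comment> \<open>Pair both sides with \<open>v - w\<close> and move the transpose across the
    inner product.\<close>
  then have "(D *v v) \<bullet> (D *v (v - w)) = (D *v w) \<bullet> (D *v (v - w))"
    by (simp flip: dot_lmul_matrix)
  then have "(D *v v - D *v w) \<bullet> (D *v v - D *v w) = 0"
    by (simp add: matrix_vector_mult_diff_distrib inner_diff_left)
  then have "D *v v = D *v w"
    by simp
  with assms show "v = w"
    by (rule injD)
qed

theorem proposition6p1:
  fixes A :: "'l::finite \<Rightarrow> real ^ 'm::finite ^ 'n::finite"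
    and b :: "'l \<Rightarrow> real ^ 'n"
    and X :: "real ^ 'r::finite ^ 'l"
    and \<xi> :: "real ^ 'r ^ 'm"
  assumes orthonormal: "emp_orthonormal X"
    and replication: "\<forall>l. A l *v hedge X \<xi> l = b l"
  shows "(solves_normal_equations A b X \<xi> \<and>
      (\<forall>Y :: real ^ 'p::finite ^ 'l. solves_moment_equations A b X Y \<xi>)) \<and>
    (rank (design_matrix A X) = CARD('m) * CARD('r) \<longrightarrow>
      (\<forall>\<xi>'. solves_normal_equations A b X \<xi>' \<longleftrightarrow> \<xi>' = \<xi>)) \<and>
    (\<forall>Y :: real ^ 'p ^ 'l. rank (projected_matrix A X Y) = CARD('m) * CARD('r) \<longrightarrow>
      (\<forall>\<xi>'. solves_moment_equations A b X Y \<xi>' \<longleftrightarrow> \<xi>' = \<xi>))"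
proof -
  have normal: "solves_normal_equations A b X \<xi>"
    using replication by (simp add: solves_normal_equations_def G_coeff_sum h_coeff_def)
  have moment: "solves_moment_equations A b X Y \<xi>" for Y :: "real ^ 'p ^ 'l"
    using replication by (simp add: solves_moment_equations_def B_coeff_sum beta_coeff_def)
  have "\<xi>' = \<xi>"
    if "rank (design_matrix A X) = CARD('m) * CARD('r)" "solves_normal_equations A b X \<xi>'" for \<xi>'
  proof -
    have "inj ((*v) (design_matrix A X))"
      \<comment> \<open>The matrix has \<open>CARD('m \<times> 'r)\<close> columns, which is the
        product in the rank hypothesis.\<close>
      using that(1) by (simp flip: full_rank_injective)
    from injD[OF inj_gram[OF this]] have "flatten \<xi>' = flatten \<xi>"
      using that(2) normal by (simp add: solves_normal_equations_iff)
    then show ?thesis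
      by (rule injD[OF inj_flatten])
  qed
  moreover have "\<xi>' = \<xi>"
    if "rank (projected_matrix A X Y) = CARD('m) * CARD('r)" "solves_moment_equations A b X Y \<xi>'"
    for Y :: "real ^ 'p ^ 'l" and \<xi>'
  proof -
    have "inj ((*v) (projected_matrix A X Y))"
      using that(1) by (simp flip: full_rank_injective)
    then have "flatten \<xi>' = flatten \<xi>"
      \<comment> \<open>Both flattened vectors are mapped to the same right-hand side, the flattened
        \<open>beta_coeff\<close>.\<close>
      by (rule injD) (use that(2) moment[of Y] in \<open>simp add: solves_moment_equations_iff\<close>)
    then show ?thesis
      by (rule injD[OF inj_flatten])
  qed
  ultimately show ?thesis
    using normal moment by blast
qed

end
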